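(* Every Thurston biautomatic group is Cayley graph biautomatic.
   Context: For a finite alphabet $\Sigma$, let $\Sigma^\star$ be the set of finite strings over $\Sigma$. For strings $w_1,\dots,w_n\in\Sigma^\star$ the convolution $\otimes(w_1,\dots,w_n)$ is the string of length $\max_i|w_i|$ over the alphabet $(\Sigma\cup\{\diamond\})^n$ (with $\diamond\notin\Sigma$) whose $k$-th symbol is $(\sigma_1,\dots,\sigma_n)$, where $\sigma_i$ is the $k$-th symbol of $w_i$ if $k\le|w_i|$ and $\sigma_i=\diamond$ otherwise. A relation $R\subseteq(\Sigma^\star)^n$ is FA recognizable if $\{\otimes(w_1,\dots,w_n)\mid (w_1,\dots,w_n)\in R\}$ is a regular language (recognized by a finite automaton). Let $G$ be a group with a finite generating set $X$, $X=X^{-1}$. A language $L\subseteq X^\star$ is part of an automatic structure for $G$ if $L$ is regular, the natural map $w\mapsto\bar w$ (product of letters) from $L$ to $G$ is onto, $\{(u,v)\in L^2\mid\bar u=\bar v\}$ is FA recognizable, and for each $x\in X$ the relation $\{(u,v)\in L^2\mid\bar u=\overline{vx}\}$ is FA recognizable. $G$ is Thurston biautomatic if, for some such $X$, there is $L\subseteq X^\star$ such that both $L$ and $L^{-1}$ are parts of automatic structures for $G$, where $L^{-1}=\{x_k^{-1}\cdots x_1^{-1}\mid x_1\cdots x_k\in L\}$. A finitely generated group $G$ is Cayley graph biautomatic if, for some finite generating set $X$, there are a finite alphabet $\Sigma$, a regular language $R\subseteq\Sigma^\star$ and a bijection $\nu:R\to G$ such that for every $x\in X$ both relations $\{(u,v)\in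 R^2\mid \nu(u)x=\nu(v)\}$ and $\{(u,v)\in R^2\mid x\nu(u)=\nu(v)\}$ are FA recognizable. *)

theory Defs
  imports "HOL-Algebra.Group" "HOL-Algebra.Generated_Groups"
begin

section \<open>Finite automata and regular languages\<close>

record ('q, 'a) dfa =
  states :: "'q set"
  init :: 'q
  trans_fun :: "'q \<Rightarrow> 'a \<Rightarrow> 'q"
  accepting :: "'q set"

definition dfa_over :: "'a set \<Rightarrow> ('q, 'a) dfa \<Rightarrow> bool" where
  "dfa_over A M \<longleftrightarrow> finite A \<and> finite (states M) \<and> init M \<in> states M \<and>
     accepting M \<subseteq> states M \<and> (\<forall>q\<in>states M. \<forall>a\<in>A. trans_fun M q a \<in> states M)"

definition dfa_language :: "'a set \<Rightarrow> ('q, 'a) dfa \<Rightarrow> 'a list set" where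
  "dfa_language A M = {w \<in> lists A. foldl (trans_fun M) (init M) w \<in> accepting M}"

text \<open>The states are natural numbers because HOL cannot quantify existentially over types;
  by the lemma \<open>regularI\<close> below, this is no restriction.\<close>

definition regular :: "'a set \<Rightarrow> 'a list set \<Rightarrow> bool" where
  "regular A L \<longleftrightarrow> (\<exists>M :: (nat, 'a) dfa. dfa_over A M \<and> L = dfa_language A M)"

lemma regularI:
  fixes M :: "('q, 'a) dfa"
  assumes M: "dfa_over A M"
  shows "regular A (dfa_language A M)"
proof -
  have fin: "finite (states M)" and i: "init M \<in> states M" and F: "accepting M \<subseteq> states M"
    and tr: "\<And>q a. q \<in> states M \<Longrightarrow> a \<in> A \<Longrightarrow> trans_fun M q a \<in> states M"
    using M by (auto simp: dfa_over_def)
  obtain h :: "'q \<Rightarrow> nat" where h: "inj_on h (states M)"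
    using finite_imp_inj_to_nat_seg[OF fin] by blast
  let ?g = "inv_into (states M) h"
  define N :: "(nat, 'a) dfa" where
    "N = \<lparr>states = h ` states M, init = h (init M),
          trans_fun = (\<lambda>q a. h (trans_fun M (?g q) a)), accepting = h ` accepting M\<rparr>"
  have N: "dfa_over A N"
    using M h by (auto simp: dfa_over_def N_def)
  have run: "foldl (trans_fun N) (h q) w = h (foldl (trans_fun M) q w) \<and>
      foldl (trans_fun M) q w \<in> states M" if "w \<in> lists A" "q \<in> states M" for w q
    using that
  proof (induction w arbitrary: q)
    case (Cons a w)
    then have "trans_fun M q a \<in> states M"
      using tr by auto
    then show ?case
      using Cons h by (auto simp: N_def)
  qed simp
  have "dfa_language A M = dfa_language A N"
    unfolding dfa_language_def
  proof (rule Collect_cong, rule conj_cong[OF refl])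
    fix w assume w: "w \<in> lists A"
    have "foldl (trans_fun N) (init N) w = h (foldl (trans_fun M) (init M) w)"
      and "foldl (trans_fun M) (init M) w \<in> states M"
      using run[OF w i] by (auto simp: N_def)
    then show "foldl (trans_fun M) (init M) w \<in> accepting M \<longleftrightarrow>
        foldl (trans_fun N) (init N) w \<in> accepting N"
      using inj_on_image_mem_iff[OF h _ F] by (simp add: N_def)
  qed
  then show ?thesis
    using N unfolding regular_def by blast
qed


section \<open>Convolutions and FA recognizable relations\<close>

text \<open>An \<open>n\<close>-tuple of words is a list of \<open>n\<close> words. The padding symbol is \<^term>\<open>None\<close>,
  and a letter \<open>a\<close> of the alphabet becomes \<^term>\<open>Some a\<close>.\<close>

definition convolution :: "'a list list \<Rightarrow> 'a option list list" where
  "convolution ws =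
     map (\<lambda>k. map (\<lambda>w. if k < length w then Some (w ! k) else None) ws)
       [0..<Max (insert 0 (length ` set ws))]"

definition padded_alphabet :: "nat \<Rightarrow> 'a set \<Rightarrow> 'a option list set" where
  "padded_alphabet n A = {s. length s = n \<and> set s \<subseteq> insert None (Some ` A)}"

definition FA_recognizable :: "'a set \<Rightarrow> nat \<Rightarrow> 'a list list set \<Rightarrow> bool" where
  "FA_recognizable A n R \<longleftrightarrow>
     R \<subseteq> {ws. length ws = n \<and> set ws \<subseteq> lists A} \<and>
     regular (padded_alphabet n A) (convolution ` R)"


section \<open>Biautomatic groups\<close>

definition word_value :: "('g, 'm) monoid_scheme \<Rightarrow> 'g list \<Rightarrow> 'g" where
  "word_value G w = foldr (mult G) w (one G)"

text \<open>Inversion of words is formal: nothing is cancelled.\<close>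

definition inverse_language :: "('g, 'm) monoid_scheme \<Rightarrow> 'g list set \<Rightarrow> 'g list set" where
  "inverse_language G L = (\<lambda>w. rev (map (m_inv G) w)) ` L"

definition finite_generating_set :: "('g, 'm) monoid_scheme \<Rightarrow> 'g set \<Rightarrow> bool" where
  "finite_generating_set G X \<longleftrightarrow> finite X \<and> X \<subseteq> carrier G \<and> generate G X = carrier G"

definition part_of_automatic_structure ::
    "('g, 'm) monoid_scheme \<Rightarrow> 'g set \<Rightarrow> 'g list set \<Rightarrow> bool" where
  "part_of_automatic_structure G X L \<longleftrightarrow>
     L \<subseteq> lists X \<and> regular X L \<and> word_value G ` L = carrier G \<and>
     FA_recognizable X 2 {[u, v] | u v. u \<in> L \<and> v \<in> L \<and> word_value G u = word_value G v} \<and>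
     (\<forall>x\<in>X. FA_recognizable X 2
        {[u, v] | u v. u \<in> L \<and> v \<in> L \<and> word_value G u = word_value G (v @ [x])})"

definition Thurston_biautomatic :: "('g, 'm) monoid_scheme \<Rightarrow> bool" where
  "Thurston_biautomatic G \<longleftrightarrow>
     (\<exists>X L. finite_generating_set G X \<and> m_inv G ` X = X \<and> L \<subseteq> lists X \<and>
        part_of_automatic_structure G X L \<and>
        part_of_automatic_structure G X (inverse_language G L))"

text \<open>The letters are natural numbers because HOL cannot quantify existentially over types;
  every finite alphabet can be renamed to a finite set of natural numbers.\<close>

definition Cayley_graph_biautomatic :: "('g, 'm) monoid_scheme \<Rightarrow> bool" where
  "Cayley_graph_biautomatic G \<longleftrightarrow>
     (\<exists>X. finite_generating_set G X \<and>
       (\<exists>(A :: nat set) R \<nu>. finite A \<and> regular A R \<and> bij_betw \<nu> R (carrier G) \<and>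
         (\<forall>x\<in>X.
            FA_recognizable A 2 {[u, v] | u v. u \<in> R \<and> v \<in> R \<and> mult G (\<nu> u) x = \<nu> v} \<and>
            FA_recognizable A 2 {[u, v] | u v. u \<in> R \<and> v \<in> R \<and> mult G x (\<nu> u) = \<nu> v})))"

end

theory Submission
  imports Defs
begin

text \<open>Let \<open>R\<close> consist of the shortlex-least representatives in \<open>L\<close> of the group elements. It is
  regular, because the dominated words are the first projection of a regular set of convolutions
  in which the first word is not the shorter one and hence is not padded. Multiplication on the right
  by a generator is inherited from \<open>L\<close>. Multiplication on the left becomes multiplication on the right
  in the inverse language, except that the words are now read backwards. Since elements have unique
  representatives in \<open>R\<close>, this relation and its converse are single-valued, so by a pumping argument
  the lengths of related words differ by a bounded amount, and an automaton with a bounded buffer can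
  realign the reversed convolutions.\<close>

section \<open>Closure properties of regular languages\<close>

text \<open>Reduces regularity to a summary \<open>f w\<close> of the input read so far, with
  finitely many values, and a rule updating it by one letter. All automata below are given in this
  way.\<close>

lemma regularI_fun:
  fixes f :: "'a list \<Rightarrow> 'q"
  assumes "finite A" "finite Q"
    and Q: "\<And>w. w \<in> lists A \<Longrightarrow> f w \<in> Q"
    and step: "\<And>w a. w \<in> lists A \<Longrightarrow> a \<in> A \<Longrightarrow> f (w @ [a]) = g (f w) a"
  shows "regular A {w \<in> lists A. P (f w)}"
proof -
  \<comment> \<open>Only attained summaries become states: \<open>step\<close> controls
    \<open>g\<close> there alone, so \<open>Q\<close> itself may fail to be closed under
    \<open>g\<close>.\<close>
  define M where "M = \<lparr>states = f ` lists A, init = f [], trans_fun = g,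
    accepting = {q \<in> f ` lists A. P q}\<rparr>"
  have "finite (f ` lists A)"
    using Q \<open>finite Q\<close> by (auto intro: finite_subset)
  moreover have "g (f w) a \<in> f ` lists A" if "w \<in> lists A" "a \<in> A" for w a
    using that step[OF that] by (intro image_eqI[of _ _ "w @ [a]"]) auto
  ultimately have "dfa_over A M"
    using \<open>finite A\<close> by (auto simp: dfa_over_def M_def)
  moreover have "foldl g (f []) w = f w" if "w \<in> lists A" for w
    using that by (induction w rule: rev_induct) (auto simp: step)
  then have "dfa_language A M = {w \<in> lists A. P (f w)}"
    unfolding dfa_language_def M_def by (intro Collect_cong conj_cong) (simp_all del: in_lists_conv_set)
  ultimately show ?thesis
    using regularI by metis
qed

lemma regularE:
  assumes "regular A L"
  obtains Q :: "nat set" and g i F where "finite A" "finite Q"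
    "\<And>w q. q \<in> Q \<Longrightarrow> w \<in> lists A \<Longrightarrow> foldl g q w \<in> Q" "i \<in> Q"
    "L = {w \<in> lists A. foldl g i w \<in> F}"
proof -
  obtain M :: "(nat, 'a) dfa" where M: "dfa_over A M" "L = dfa_language A M"
    using assms by (auto simp: regular_def)
  have "foldl (trans_fun M) q w \<in> states M" if "q \<in> states M" "w \<in> lists A" for q w
    using that M(1) by (induction w arbitrary: q) (auto simp: dfa_over_def)
  then show thesis
    using M by (intro that[of "states M" "trans_fun M" "init M"])
      (auto simp: dfa_over_def dfa_language_def)
qed

lemma regular_finite: "regular A L \<Longrightarrow> finite A"
  by (auto simp: regular_def dfa_over_def)

lemma regular_lists: "regular A L \<Longrightarrow> L \<subseteq> lists A"
  by (auto simp: regular_def dfa_language_def)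

text \<open>The product automaton decides both memberships at once; leaving the connective
  \<open>P\<close> open yields intersection, union and difference together.\<close>

lemma regular_combine:
  assumes "regular A K" "regular A L"
  shows "regular A {w \<in> lists A. P (w \<in> K) (w \<in> L)}"
proof -
  obtain Q :: "nat set" and g i F where 1: "finite A" "finite Q"
    "\<And>w q. q \<in> Q \<Longrightarrow> w \<in> lists A \<Longrightarrow> foldl g q w \<in> Q" "i \<in> Q"
    "K = {w \<in> lists A. foldl g i w \<in> F}"
    by (rule regularE[OF assms(1)], rule that)
  obtain Q' :: "nat set" and g' i' F' where 2: "finite Q'"
    "\<And>w q. q \<in> Q' \<Longrightarrow> w \<in> lists A \<Longrightarrow> foldl g' q w \<in> Q'" "i' \<in> Q'"
    "L = {w \<in> lists A. foldl g' i' w \<in> F'}"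
    by (rule regularE[OF assms(2)], rule that)
  have "{w \<in> lists A. P (w \<in> K) (w \<in> L)} =
     {w \<in> lists A. (\<lambda>(q, q'). P (q \<in> F) (q' \<in> F')) (foldl g i w, foldl g' i' w)}"
    using 1(5) 2(4) by (intro Collect_cong conj_cong) auto
  also have "regular A \<dots>"
    by (rule regularI_fun[where Q = "Q \<times> Q'" and g = "\<lambda>(q, q') a. (g q a, g' q' a)"])
      (use 1 2 in auto)
  finally show ?thesis .
qed

lemma regular_Int:
  assumes "regular A K" "regular A L"
  shows "regular A (K \<inter> L)"
  using regular_combine[OF assms, of "(\<and>)"] regular_lists[OF assms(1)]
  by (auto elim!: back_subst[of "regular A"])

lemma regular_Un:
  assumes "regular A K" "regular A L"
  shows "regular A (K \<union> L)"
  using regular_combine[OF assms, of "(\<or>)"] regular_lists[OF assms(1)] regular_lists[OF assms(2)]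
  by (auto elim!: back_subst[of "regular A"])

lemma regular_Diff:
  assumes "regular A K" "regular A L"
  shows "regular A (K - L)"
  using regular_combine[OF assms, of "\<lambda>p q. p \<and> \<not> q"] regular_lists[OF assms(1)]
  by (auto elim!: back_subst[of "regular A"])

lemma regular_empty: "finite A \<Longrightarrow> regular A {}"
  using regularI_fun[of A "{()}" "\<lambda>_. ()" "\<lambda>_ _. ()" "\<lambda>_. False"] by simp

lemma regular_UN:
  assumes "finite I" "finite A" "\<And>i. i \<in> I \<Longrightarrow> regular A (L i)"
  shows "regular A (\<Union>i\<in>I. L i)"
  using assms by (induction I rule: finite_induct) (auto intro: regular_empty regular_Un)

text \<open>Subset construction: after \<open>w\<close> the automaton holds all states reached by
  words that \<open>h\<close> maps to \<open>w\<close>. Only images of words in \<open>L\<close>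
  must stay over \<open>B\<close>, so \<open>h\<close> may take junk values on other letters, as
  \<open>the\<close> does on \<open>None\<close>.\<close>

lemma regular_map_lists:
  assumes "regular A L" "finite B" "map h ` L \<subseteq> lists B"
  shows "regular B (map h ` L)"
proof -
  obtain Q :: "nat set" and g i F where 1: "finite A" "finite Q"
    "\<And>w q. q \<in> Q \<Longrightarrow> w \<in> lists A \<Longrightarrow> foldl g q w \<in> Q" "i \<in> Q"
    "L = {w \<in> lists A. foldl g i w \<in> F}"
    by (rule regularE[OF assms(1)], rule that)
  define f where "f w = foldl g i ` {v \<in> lists A. map h v = w}" for w
  have step: "f (w @ [b]) = {g q a |q a. q \<in> f w \<and> a \<in> A \<and> h a = b}" (is "_ = ?R") for w b
  proof (intro equalityI subsetI)
    fix q
    assume "q \<in> f (w @ [b])"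
    then obtain v where v: "v \<in> lists A" "map h v = w @ [b]" "q = foldl g i v"
      by (auto simp: f_def)
    then obtain v' a where "v = v' @ [a]"
      by (cases v rule: rev_cases) auto
    then show "q \<in> ?R"
      using v by (auto simp: f_def)
  next
    fix q
    assume "q \<in> ?R"
    then obtain v a where "v \<in> lists A" "map h v = w" "a \<in> A" "h a = b" "q = g (foldl g i v) a"
      by (auto simp: f_def)
    then show "q \<in> f (w @ [b])"
      by (auto simp: f_def intro!: image_eqI[of _ _ "v @ [a]"])
  qed
  have "map h ` L = {w \<in> lists B. f w \<inter> F \<noteq> {}}"
    using assms(3) unfolding f_def 1(5) by blast
  also have "regular B \<dots>"
    by (rule regularI_fun[where Q = "Pow Q" and g = "\<lambda>S b. {g q a |q a. q \<in> S \<and> a \<in> A \<and> h a = b}"])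
      (use assms 1 step in \<open>auto simp: f_def\<close>)
  finally show ?thesis .
qed

lemma regular_map:
  assumes "regular A L" "finite B" "h ` A \<subseteq> B"
  shows "regular B (map h ` L)"
proof -
  have "map h ` L \<subseteq> map h ` lists A"
    using regular_lists[OF assms(1)] by (rule image_mono)
  also have "\<dots> \<subseteq> lists B"
    using assms(3) by (auto simp flip: lists_image)
  finally show ?thesis
    by (rule regular_map_lists[OF assms(1,2)])
qed

lemma regular_rev:
  assumes "regular A L"
  shows "regular A (rev ` L)"
proof -
  obtain Q :: "nat set" and g i F where 1: "finite A" "finite Q"
    "\<And>w q. q \<in> Q \<Longrightarrow> w \<in> lists A \<Longrightarrow> foldl g q w \<in> Q" "i \<in> Q"
    "L = {w \<in> lists A. foldl g i w \<in> F}"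
    by (rule regularE[OF assms(1)], rule that)
  \<comment> \<open>The states from which \<open>rev w\<close> is accepted. As
    \<open>rev (w @ [a])\<close> starts with \<open>a\<close>, this set can be updated when
    \<open>a\<close> is read: a backward subset construction.\<close>
  define f where "f w = {q \<in> Q. foldl g q (rev w) \<in> F}" for w
  have g: "g q a \<in> Q" if "q \<in> Q" "a \<in> A" for q a
    using 1(3)[of q "[a]"] that by simp
  have "rev ` L = {w \<in> lists A. i \<in> f w}"
    using 1(4,5) by (auto simp: f_def intro!: image_eqI[of _ _ "rev _"])
  also have "regular A \<dots>"
    by (rule regularI_fun[where Q = "Pow Q" and g = "\<lambda>S a. {q \<in> Q. g q a \<in> S}"])
      (use assms 1 g in \<open>auto simp: f_def\<close>)
  finally show ?thesis .
qed

section \<open>Convolutions of pairs\<close>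

definition pad_alphabet :: "'a set \<Rightarrow> ('a option \<times> 'a option) set" where
  "pad_alphabet A = insert None (Some ` A) \<times> insert None (Some ` A)"

text \<open>The binary convolution with pairs as letters and explicit padding, so that its
  projections are easy to compute. Truncated subtraction makes at most one of the two paddings
  nonempty.\<close>

definition conv2 :: "'a list \<times> 'a list \<Rightarrow> ('a option \<times> 'a option) list" where
  "conv2 = (\<lambda>(u, v). zip (map Some u @ replicate (length v - length u) None)
     (map Some v @ replicate (length u - length v) None))"

definition FA2 :: "'a set \<Rightarrow> ('a list \<times> 'a list) set \<Rightarrow> bool" where
  "FA2 A W \<longleftrightarrow> finite A \<and> W \<subseteq> lists A \<times> lists A \<and> regular (pad_alphabet A) (conv2 ` W)"

lemma finite_pad_alphabet: "finite A \<Longrightarrow> finite (pad_alphabet A)"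
  by (simp add: pad_alphabet_def)

lemma map_fst_conv2: "map fst (conv2 (u, v)) = map Some u @ replicate (length v - length u) None"
  by (simp add: conv2_def)

lemma map_snd_conv2: "map snd (conv2 (u, v)) = map Some v @ replicate (length u - length v) None"
  by (simp add: conv2_def)

lemma length_conv2: "length (conv2 (u, v)) = max (length u) (length v)"
  by (simp add: conv2_def)

lemma nth_conv2:
  assumes "i < max (length u) (length v)"
  shows "conv2 (u, v) ! i =
    (if i < length u then Some (u ! i) else None, if i < length v then Some (v ! i) else None)"
proof -
  have "i < length (map Some u @ replicate (length v - length u) None)"
    "i < length (map Some v @ replicate (length u - length v) None)"
    using assms by auto
  then show ?thesis
    unfolding conv2_def by (simp add: nth_append)
qed

lemma pad_word_eqI: "map fst w = map fst w' \<Longrightarrow> map snd w = map snd w' \<Longrightarrow> w = w'"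
  by (metis zip_map_fst_snd)

lemma conv2_in_lists:
  assumes "u \<in> lists A" "v \<in> lists A"
  shows "conv2 (u, v) \<in> lists (pad_alphabet A)"
proof -
  have "set (conv2 (u, v)) \<subseteq> set (map fst (conv2 (u, v))) \<times> set (map snd (conv2 (u, v)))"
    by force
  also have "\<dots> \<subseteq> pad_alphabet A"
    unfolding map_fst_conv2 map_snd_conv2 using assms by (auto simp: pad_alphabet_def)
  finally show ?thesis by auto
qed

lemma map_filter_append: "List.map_filter f (u @ v) = List.map_filter f u @ List.map_filter f v"
  by (simp add: List.map_filter_def)

lemma map_filter_pad: "List.map_filter id (map Some u @ replicate n None) = u"
proof -
  have "List.map_filter id (replicate n None) = []" for n :: nat
    by (induction n) auto
  moreover have "List.map_filter id (map Some u) = u"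
    by (induction u) auto
  ultimately show ?thesis
    by (simp add: map_filter_append)
qed

lemma map_filter_fst_conv2: "List.map_filter id (map fst (conv2 (u, v))) = u"
  and map_filter_snd_conv2: "List.map_filter id (map snd (conv2 (u, v))) = v"
  unfolding map_fst_conv2 map_snd_conv2 by (rule map_filter_pad)+

text \<open>Deleting the padding from each component decodes the pair.\<close>

lemma inj_conv2: "inj conv2"
  by (rule injI) (metis map_filter_fst_conv2 map_filter_snd_conv2 surj_pair)

lemma conv2_eq_iff: "conv2 p = conv2 q \<longleftrightarrow> p = q"
  by (rule inj_eq[OF inj_conv2])

text \<open>The automaton of \<open>L\<close> runs on one component and stands still on padding. The
  uses are \<open>h = fst\<close> and \<open>h = snd\<close>.\<close>

lemma regular_component:
  assumes "regular A L" "\<And>s. s \<in> pad_alphabet A \<Longrightarrow> h s \<in> insert None (Some ` A)"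
  shows "regular (pad_alphabet A)
    {w \<in> lists (pad_alphabet A). List.map_filter id (map h w) \<in> L}"
proof -
  obtain Q :: "nat set" and g i F where 1: "finite A" "finite Q"
    "\<And>w q. q \<in> Q \<Longrightarrow> w \<in> lists A \<Longrightarrow> foldl g q w \<in> Q" "i \<in> Q"
    "L = {w \<in> lists A. foldl g i w \<in> F}"
    by (rule regularE[OF assms(1)], rule that)
  have in_lists: "List.map_filter id (map h w) \<in> lists A" if "w \<in> lists (pad_alphabet A)" for w
    using that
  proof (induction w)
    case (Cons s w)
    then show ?case
      using assms(2)[of s] by (auto split: option.splits)
  qed simp
  have "{w \<in> lists (pad_alphabet A). List.map_filter id (map h w) \<in> L} =
    {w \<in> lists (pad_alphabet A). foldl g i (List.map_filter id (map h w)) \<in> F}"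
    using in_lists 1(5) by auto
  also have "regular (pad_alphabet A) \<dots>"
    by (rule regularI_fun[where Q = Q and
          g = "\<lambda>q s. case h s of None \<Rightarrow> q | Some a \<Rightarrow> g q a"])
      (use 1 in_lists in \<open>auto simp: finite_pad_alphabet map_filter_append split: option.split\<close>)
  finally show ?thesis .
qed

lemma FA2_conv2_in_lists: "FA2 A W \<Longrightarrow> p \<in> W \<Longrightarrow> conv2 p \<in> lists (pad_alphabet A)"
  unfolding FA2_def by (metis conv2_in_lists mem_Sigma_iff subsetD surj_pair)

lemma FA2_restrict:
  assumes "FA2 A W" "regular A L"
  shows "FA2 A (W \<inter> L \<times> L)"
proof -
  note inl = FA2_conv2_in_lists[OF assms(1)]
  let ?C = "\<lambda>h. {w \<in> lists (pad_alphabet A). List.map_filter id (map h w) \<in> L}"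
  have "regular (pad_alphabet A) (conv2 ` W \<inter> (?C fst \<inter> ?C snd))"
    using assms by (intro regular_Int regular_component) (auto simp: FA2_def pad_alphabet_def)
  also have "conv2 ` W \<inter> (?C fst \<inter> ?C snd) = conv2 ` (W \<inter> L \<times> L)"
    using inl by (auto simp: map_filter_fst_conv2 map_filter_snd_conv2)
  finally show ?thesis
    using assms by (auto simp: FA2_def)
qed

lemma FA2_swap:
  assumes "FA2 A W"
  shows "FA2 A (W\<inverse>)"
proof -
  have *: "conv2 (v, u) = map prod.swap (conv2 (u, v))" for u v :: "'a list"
    by (rule pad_word_eqI) (simp_all add: map_fst_conv2 map_snd_conv2 comp_def)
  have "regular (pad_alphabet A) (map prod.swap ` conv2 ` W)"
    using assms by (intro regular_map[of "pad_alphabet A"])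
      (auto simp: FA2_def pad_alphabet_def)
  also have "map prod.swap ` conv2 ` W = conv2 ` W\<inverse>"
    by (force simp: *[symmetric] image_iff)
  finally show ?thesis
    using assms by (auto simp: FA2_def)
qed

lemma map_fst_map_prod: "map fst (map (map_prod f g) w) = map f (map fst w)"
  and map_snd_map_prod: "map snd (map (map_prod f g) w) = map g (map snd w)"
  by simp_all

text \<open>A letterwise map preserves lengths, hence padding, and so acts letter by letter on
  convolutions.\<close>

lemma FA2_map:
  assumes "FA2 A W" "finite B" "h ` A \<subseteq> B"
  shows "FA2 B ((\<lambda>(u, v). (map h u, map h v)) ` W)"
proof -
  have *: "conv2 (map h u, map h v) = map (map_prod (map_option h) (map_option h)) (conv2 (u, v))"
    for u v
    by (rule pad_word_eqI)
      (simp_all only: map_fst_conv2 map_snd_conv2 map_fst_map_prod map_snd_map_prod, simp_all)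
  have "regular (pad_alphabet B) (map (map_prod (map_option h) (map_option h)) ` conv2 ` W)"
    using assms by (intro regular_map[of "pad_alphabet A"])
      (auto simp: FA2_def pad_alphabet_def)
  also have "map (map_prod (map_option h) (map_option h)) ` conv2 ` W =
      conv2 ` (\<lambda>(u, v). (map h u, map h v)) ` W"
    by (force simp: * image_iff)
  finally show ?thesis
    using assms by (fastforce simp: FA2_def)
qed

text \<open>The letters \<open>[a, b]\<close> and \<open>(a, b)\<close> correspond one to one, so
  regularity passes both ways by relabelling. After this, only \<open>FA2\<close> has to be
  handled.\<close>

lemma FA_recognizable_iff_FA2:
  assumes "finite A" "W \<subseteq> lists A \<times> lists A"
  shows "FA_recognizable A 2 {[u, v] |u v. (u, v) \<in> W} \<longleftrightarrow> FA2 A W"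
proof -
  let ?l = "\<lambda>(a, b). [a, b]" and ?p = "\<lambda>s. (s ! 0, s ! 1)"
  have pad: "padded_alphabet 2 A = ?l ` pad_alphabet A"
  proof (intro equalityI subsetI)
    fix s
    assume "s \<in> padded_alphabet 2 A"
    then obtain a b where "s = [a, b]" "a \<in> insert None (Some ` A)" "b \<in> insert None (Some ` A)"
      by (auto simp: padded_alphabet_def length_Suc_conv numeral_2_eq_2)
    then show "s \<in> ?l ` pad_alphabet A"
      unfolding pad_alphabet_def by (intro image_eqI[of _ _ "(a, b)"]) auto
  qed (auto simp: padded_alphabet_def pad_alphabet_def)
  have conv: "convolution [u, v] = map ?l (conv2 (u, v))" for u v :: "'a list"
    by (rule nth_equalityI) (simp_all add: convolution_def length_conv2 nth_conv2)
  let ?R = "{[u, v] |u v. (u, v) \<in> W}"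
  have 1: "convolution ` ?R = map ?l ` conv2 ` W"
    by (force simp: conv image_iff)
  have 2: "conv2 ` W = map ?p ` convolution ` ?R"
    unfolding 1 by (simp add: image_image o_def case_prod_beta)
  have "regular (padded_alphabet 2 A) (convolution ` ?R) \<longleftrightarrow> regular (pad_alphabet A) (conv2 ` W)"
  proof
    assume "regular (padded_alphabet 2 A) (convolution ` ?R)"
    then show "regular (pad_alphabet A) (conv2 ` W)"
      unfolding 2 by (rule regular_map) (auto simp: pad finite_pad_alphabet assms)
  next
    assume "regular (pad_alphabet A) (conv2 ` W)"
    then show "regular (padded_alphabet 2 A) (convolution ` ?R)"
      unfolding 1 by (rule regular_map) (auto simp: pad finite_pad_alphabet assms)
  qed
  moreover have "?R \<subseteq> {ws. length ws = 2 \<and> set ws \<subseteq> lists A}"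
    by (auto dest!: subsetD[OF assms(2)])
  ultimately show ?thesis
    using assms by (simp add: FA_recognizable_def FA2_def)
qed

section \<open>Shortlex comparison of related words\<close>

lemma regular_None_occurs:
  assumes "finite A"
  shows "regular A {w \<in> lists A. P (None \<in> set (map h w))}"
  by (rule regularI_fun[where Q = UNIV and g = "\<lambda>b s. b \<or> h s = None"]) (use assms in auto)

lemma lex_snoc:
  "length u = length v \<Longrightarrow>
    (u @ [a], v @ [b]) \<in> lex r \<longleftrightarrow> (u, v) \<in> lex r \<or> u = v \<and> (a, b) \<in> r"
  by (induction u v rule: list_induct2) auto

text \<open>Two bits suffice: whether the order is already decided in favour of the first word, and
  whether the words agree so far. The second bit is carried along only for the update in
  \<open>lex_snoc\<close>.\<close>

lemma regular_lex:
  assumes "finite A"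
  shows "regular A {w \<in> lists A. (map h w, map k w) \<in> lex r}"
proof -
  have "regular A {w \<in> lists A. fst ((map h w, map k w) \<in> lex r, map h w = map k w)}"
    by (rule regularI_fun[where Q = UNIV and
          g = "\<lambda>(l, e) s. (l \<or> e \<and> (h s, k s) \<in> r, e \<and> h s = k s)"])
      (use assms in \<open>auto simp: lex_snoc\<close>)
  then show ?thesis by simp
qed

text \<open>The shortlex condition is visible in the padding: either the second component is padded,
  or neither is and the words compare lexicographically.\<close>

lemma regular_shortlex_dominated:
  fixes e :: "'a \<Rightarrow> nat"
  assumes "FA2 A W"
  shows "regular A {u. \<exists>v. (u, v) \<in> W \<and> (map e v, map e u) \<in> lenlex less_than}"
proof -
  \<comment> \<open>The value 0 for padding is arbitrary: for unequal lengths \<open>?N1\<close> and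
    \<open>?N2\<close> settle the comparison, whatever \<open>?Lx\<close> says.\<close>
  let ?P = "pad_alphabet A" and ?c = "case_option 0 e"
  let ?N1 = "{w \<in> lists ?P. \<not> None \<in> set (map fst w)}"
  let ?N2 = "{w \<in> lists ?P. None \<in> set (map snd w)}"
  let ?Lx = "{w \<in> lists ?P. (map (?c \<circ> snd) w, map (?c \<circ> fst) w) \<in> lex less_than}"
  let ?K = "conv2 ` W \<inter> (?N1 \<inter> (?N2 \<union> ?Lx))"
  let ?D = "{u. \<exists>v. (u, v) \<in> W \<and> (map e v, map e u) \<in> lenlex less_than}"
  have fin: "finite ?P" and sub: "W \<subseteq> lists A \<times> lists A" and reg: "regular ?P (conv2 ` W)"
    using assms by (auto simp: FA2_def finite_pad_alphabet)
  have K: "regular ?P ?K"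
    using reg fin by (intro regular_Int regular_Un regular_None_occurs regular_lex)
  have mem: "conv2 (u, v) \<in> ?N1 \<inter> (?N2 \<union> ?Lx) \<longleftrightarrow> (map e v, map e u) \<in> lenlex less_than"
    if "(u, v) \<in> W" for u v
  proof -
    have "conv2 (u, v) \<in> lists ?P"
      using FA2_conv2_in_lists[OF assms that] .
    moreover have "None \<notin> set (map fst (conv2 (u, v))) \<longleftrightarrow> length v \<le> length u"
      "None \<in> set (map snd (conv2 (u, v))) \<longleftrightarrow> length v < length u"
      unfolding map_fst_conv2 map_snd_conv2 by auto
    moreover have "map (?c \<circ> fst) (conv2 (u, v)) = map e u"
      "map (?c \<circ> snd) (conv2 (u, v)) = map e v" if "length u = length v"
      unfolding map_map[symmetric] map_fst_conv2 map_snd_conv2 using that by simp_all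
    ultimately show ?thesis
      by (cases "length u" "length v" rule: linorder_cases) (auto simp: lenlex_conv)
  qed
  \<comment> \<open>The first component carries no padding here, so \<open>the\<close> meets only
    \<open>Some\<close> letters.\<close>
  have fst_K: "map (the \<circ> fst) (conv2 (u, v)) = u" if "length v \<le> length u" for u v :: "'a list"
    unfolding map_map[symmetric] map_fst_conv2 using that by (simp add: comp_def)
  have "?D = map (the \<circ> fst) ` ?K"
  proof (intro equalityI subsetI)
    fix u
    assume "u \<in> ?D"
    then obtain v where v: "(u, v) \<in> W" "(map e v, map e u) \<in> lenlex less_than" by blast
    then have "conv2 (u, v) \<in> ?K"
      using mem[OF v(1)] by blast
    moreover have "length v \<le> length u"
      using lenlex_length[OF v(2)] by simp
    ultimately show "u \<in> map (the \<circ> fst) ` ?K"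
      using fst_K by (metis (no_types, lifting) image_eqI)
  next
    fix x
    assume "x \<in> map (the \<circ> fst) ` ?K"
    then obtain w where w: "w \<in> ?K" "x = map (the \<circ> fst) w" by blast
    then obtain u v where uv: "w = conv2 (u, v)" "(u, v) \<in> W" by auto
    then have "(map e v, map e u) \<in> lenlex less_than"
      using mem[OF uv(2)] w by blast
    moreover from this have "x = u"
      using w uv lenlex_length[of "map e v" "map e u"] fst_K by simp
    ultimately show "x \<in> ?D"
      using uv by blast
  qed
  moreover from sub have "?D \<subseteq> lists A" by blast
  ultimately show ?thesis
    using assms regular_map_lists[OF K, of A "the \<circ> fst"] by (simp add: FA2_def)
qed

section \<open>Reversal of FA recognizable relations\<close>

lemma FA2_UN:
  assumes "finite I" "finite A" "\<And>i. i \<in> I \<Longrightarrow> FA2 A (W i)"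
  shows "FA2 A (\<Union>i\<in>I. W i)"
  using assms unfolding FA2_def image_UN by (auto intro!: regular_UN simp: finite_pad_alphabet)

lemma FA2_Un:
  assumes "FA2 A V" "FA2 A W"
  shows "FA2 A (V \<union> W)"
  using assms unfolding FA2_def image_Un by (auto intro!: regular_Un)

text \<open>Pumping: if \<open>v\<close> outran \<open>u\<close> by more than the number of states,
  a loop could be cut out of the part where \<open>u\<close> is already exhausted, and
  \<open>u\<close> would be related to a second, shorter word.\<close>

lemma FA2_length_bound:
  assumes W: "FA2 A W" and unique: "single_valued W"
  shows "\<exists>N. \<forall>(u, v) \<in> W. length v \<le> length u + N"
proof -
  let ?P = "pad_alphabet A"
  have reg: "regular ?P (conv2 ` W)"
    using W by (simp add: FA2_def)
  obtain Q :: "nat set" and g i F where Q: "finite ?P" "finite Q"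
    "\<And>w q. q \<in> Q \<Longrightarrow> w \<in> lists ?P \<Longrightarrow> foldl g q w \<in> Q" "i \<in> Q"
    "conv2 ` W = {w \<in> lists ?P. foldl g i w \<in> F}"
    by (rule regularE[OF reg], rule that)
  have False if uv: "(u, v) \<in> W" and len: "length u + card Q < length v" for u v
  proof -
    define w where "w = conv2 (u, v)"
    \<comment> \<open>From position \<open>length u\<close> on, the first component is pure padding;
      among the \<open>card Q + 1\<close> states recorded there, two coincide.\<close>
    define s where "s k = foldl g i (take (length u + k) w)" for k
    have w: "w \<in> lists ?P" "foldl g i w \<in> F"
      using uv Q(5) w_def by blast+
    have "s ` {..card Q} \<subseteq> Q"
      using w(1) by (auto simp: s_def intro!: Q dest: in_set_takeD)
    then have "\<not> inj_on s {..card Q}"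
      using card_inj_on_le[of s "{..card Q}" Q] \<open>finite Q\<close> by auto
    then obtain k l where "k \<le> card Q" "l \<le> card Q" "s k = s l" "k \<noteq> l"
      by (auto simp: inj_on_def)
    then obtain k l where kl: "k < l" "l \<le> card Q" "s k = s l"
      by (metis nat_neq_iff)
    \<comment> \<open>Cuts out the loop. The first component loses only padding, the second loses
      \<open>l - k\<close> letters of \<open>v\<close>.\<close>
    let ?t = "\<lambda>x. take (length u + k) x @ drop (length u + l) x"
    have "foldl g i (?t w) = foldl g (s l) (drop (length u + l) w)"
      using kl by (simp add: s_def)
    also have "\<dots> = foldl g i w"
      unfolding s_def by (simp flip: foldl_append)
    finally have "?t w \<in> conv2 ` W"
      using w Q(5) by (auto dest: in_set_takeD in_set_dropD)
    moreover have "?t w = conv2 (u, ?t v)"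
    proof (rule pad_word_eqI)
      have "map fst (?t w) = ?t (map fst w)" "map snd (?t w) = ?t (map snd w)"
        by (simp_all add: take_map drop_map)
      then show "map fst (?t w) = map fst (conv2 (u, ?t v))"
        "map snd (?t w) = map snd (conv2 (u, ?t v))"
        unfolding w_def map_fst_conv2 map_snd_conv2 using kl len
        by (auto simp: take_map drop_map min_def simp flip: replicate_add)
    qed
    ultimately have "(u, ?t v) \<in> W"
      by (auto simp: conv2_eq_iff)
    then have "v = ?t v"
      using unique uv by (blast dest: single_valuedD)
    then have "length v = length (?t v)" by (rule arg_cong)
    then show False
      using kl len by simp
  qed
  then show ?thesis
    by (intro exI[of _ "card Q"]) (auto simp: not_less[symmetric])
qed

text \<open>The difference can be read off the padding: none in the second component and exactly
  \<open>d\<close> symbols in the first.\<close>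

lemma FA2_length_diff:
  assumes W: "FA2 A W"
  shows "FA2 A {(u, v) \<in> W. length v = length u + d}"
proof -
  let ?P = "pad_alphabet A"
  have fin: "finite ?P" and reg: "regular ?P (conv2 ` W)"
    using assms by (auto simp: FA2_def finite_pad_alphabet)
  let ?N = "{w \<in> lists ?P. \<not> None \<in> set (map snd w)}"
  \<comment> \<open>The counter saturates at \<open>Suc d\<close>, which keeps it finite and still
    separates \<open>d\<close> from larger counts.\<close>
  let ?C = "{w \<in> lists ?P. min (Suc d) (count_list (map fst w) None) = d}"
  have "regular ?P ?C"
    by (rule regularI_fun[where Q = "{..Suc d}" and
          g = "\<lambda>m s. min (Suc d) (m + (if fst s = None then 1 else 0))"])
      (use fin in auto)
  then have "regular ?P (conv2 ` W \<inter> (?N \<inter> ?C))"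
    using reg fin by (intro regular_Int regular_None_occurs)
  moreover have "conv2 (u, v) \<in> ?N \<inter> ?C \<longleftrightarrow> length v = length u + d" if "(u, v) \<in> W" for u v
  proof -
    have "conv2 (u, v) \<in> lists ?P"
      using FA2_conv2_in_lists[OF assms that] .
    moreover have "count_list (replicate n (None :: 'a option)) None = n" for n
      by (induction n) auto
    moreover have "None \<notin> set (map Some x)" for x :: "'a list"
      by auto
    ultimately show ?thesis
      unfolding mem_Collect_eq Int_iff map_fst_conv2 map_snd_conv2
      by (auto simp: min_def)
  qed
  moreover have "conv2 ` W \<inter> S = conv2 ` {(u, v) \<in> W. length v = length u + d}"
    if "\<And>u v. (u, v) \<in> W \<Longrightarrow> conv2 (u, v) \<in> S \<longleftrightarrow> length v = length u + d" for S
    using that by auto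
  ultimately show ?thesis
    using assms by (auto simp: FA2_def)
qed

text \<open>Reversing a convolution puts the padding in front. To move it back to the end, the automaton
  delays the first component by \<open>d\<close> letters, which it keeps in a buffer.\<close>

lemma FA2_rev_length_diff:
  assumes W: "FA2 A W" and d: "\<And>u v. (u, v) \<in> W \<Longrightarrow> length v = length u + d"
  shows "FA2 A ((\<lambda>(u, v). (rev u, rev v)) ` W)"
proof -
  let ?P = "pad_alphabet A" and ?V = "rev ` conv2 ` W" and ?n = "replicate d None"
  have reg: "regular ?P ?V"
    using W by (auto simp: FA2_def intro: regular_rev)
  have sub: "W \<subseteq> lists A \<times> lists A" and "finite A"
    using assms by (auto simp: FA2_def)
  obtain Q :: "nat set" and g i F where Q: "finite ?P" "finite Q"
    "\<And>w q. q \<in> Q \<Longrightarrow> w \<in> lists ?P \<Longrightarrow> foldl g q w \<in> Q" "i \<in> Q"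
    "?V = {w \<in> lists ?P. foldl g i w \<in> F}"
    by (rule regularE[OF reg], rule that)
  \<comment> \<open>\<open>x t\<close> is the first component delayed by \<open>d\<close> padding
    symbols. Its first \<open>length t\<close> symbols are paired with the second component in
    \<open>h t\<close>; the remaining \<open>d\<close> form the buffer \<open>b t\<close>.\<close>
  define x where "x t = ?n @ map fst t" for t :: "('a option \<times> 'a option) list"
  define h where "h t = zip (take (length t) (x t)) (map snd t)" for t
  define b where "b t = drop (length t) (x t)" for t
  \<comment> \<open>The buffer is a queue. Appending the new letter before taking the head makes
    this correct for \<open>d = 0\<close> as well.\<close>
  define g' where "g' = (\<lambda>(q, y) (a, c). (g q (hd (y @ [a]), c), tl (y @ [a])))"
  have fst_h: "map fst (h t) = take (length t) (x t)" and snd_h: "map snd (h t) = map snd t" for t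
    by (simp_all add: h_def x_def)
  have rev_fst: "map fst (rev (conv2 (u, v))) = ?n @ map Some (rev u)"
    and rev_snd: "map snd (rev (conv2 (u, v))) = map Some (rev v)" if "(u, v) \<in> W" for u v
    unfolding rev_map[symmetric] map_fst_conv2 map_snd_conv2 using d[OF that]
    by (simp_all add: rev_map)
  have conv_fst: "map fst (conv2 (rev u, rev v)) = map Some (rev u) @ ?n"
    and conv_snd: "map snd (conv2 (rev u, rev v)) = map Some (rev v)" if "(u, v) \<in> W" for u v
    unfolding map_fst_conv2 map_snd_conv2 using d[OF that] by simp_all
  have x_set: "set (x t) \<subseteq> insert None (Some ` A)" if "t \<in> lists ?P" for t
    using that by (auto simp: x_def pad_alphabet_def)
  have h_lists: "h t \<in> lists ?P" if "t \<in> lists ?P" for t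
  proof -
    have "set (h t) \<subseteq> set (map fst (h t)) \<times> set (map snd (h t))"
      by force
    also have "\<dots> \<subseteq> set (x t) \<times> set (map snd t)"
      unfolding fst_h snd_h using set_take_subset by fast
    also have "\<dots> \<subseteq> ?P"
      using x_set[OF that] that by (auto simp: pad_alphabet_def)
    finally show ?thesis by auto
  qed
  have step: "h (t @ [(a, c)]) = h t @ [(hd (b t @ [a]), c)] \<and> b (t @ [(a, c)]) = tl (b t @ [a])"
    for t a c
  proof -
    have y: "x (t @ [(a, c)]) = x t @ [a]" "length t \<le> length (x t)"
      by (simp_all add: x_def)
    then have "drop (length t) (x t @ [a]) = b t @ [a]" "length t < length (x t @ [a])"
      by (simp_all add: b_def)
    moreover have "take (Suc n) z = take n z @ [hd (drop n z)]" "drop (Suc n) z = tl (drop n z)"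
      if "n < length z" for n and z :: "'a option list"
      using that by (simp_all add: take_hd_drop drop_Suc tl_drop)
    ultimately have tk: "take (Suc (length t)) (x t @ [a]) = take (length t) (x t) @ [hd (b t @ [a])]"
      "drop (Suc (length t)) (x t @ [a]) = tl (b t @ [a])"
      using y(2) by (simp_all del: drop_append take_append) (simp add: take_append)
    then show ?thesis
      using y(2) by (simp add: h_def b_def[of "t @ [(a, c)]"] y(1) min_absorb2
          del: take_append drop_append)
  qed
  \<comment> \<open>Besides \<open>h t\<close> being a reversed convolution, the final buffer must
    be pure padding: this says that the first component of \<open>t\<close> ends with the padding
    that was moved away from the front.\<close>
  have "conv2 ` (\<lambda>(u, v). (rev u, rev v)) ` W =
    {t \<in> lists ?P. (\<lambda>(q, y). q \<in> F \<and> y = ?n) (foldl g i (h t), b t)}"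
  proof (intro equalityI subsetI)
    fix t
    assume "t \<in> conv2 ` (\<lambda>(u, v). (rev u, rev v)) ` W"
    then obtain u v where uv: "(u, v) \<in> W" "t = conv2 (rev u, rev v)" by auto
    have len: "length t = length u + d"
      using uv d by (simp add: length_conv2)
    have x: "x t = ?n @ map Some (rev u) @ ?n"
      unfolding x_def uv(2) conv_fst[OF uv(1)] ..
    have "h t = rev (conv2 (u, v))"
    proof (rule pad_word_eqI)
      show "map fst (h t) = map fst (rev (conv2 (u, v)))"
        unfolding fst_h x len rev_fst[OF uv(1)] by simp
      show "map snd (h t) = map snd (rev (conv2 (u, v)))"
        unfolding snd_h uv(2) conv_snd[OF uv(1)] rev_snd[OF uv(1)] ..
    qed
    then have "h t \<in> ?V"
      using uv(1) by blast
    moreover have "b t = ?n"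
      using len by (simp add: b_def x)
    moreover have "t \<in> lists ?P"
      using uv sub unfolding uv(2) by (intro conv2_in_lists) auto
    ultimately show "t \<in> {t \<in> lists ?P. (\<lambda>(q, y). q \<in> F \<and> y = ?n) (foldl g i (h t), b t)}"
      using Q(5) by simp
  next
    fix t
    assume "t \<in> {t \<in> lists ?P. (\<lambda>(q, y). q \<in> F \<and> y = ?n) (foldl g i (h t), b t)}"
    then have t: "t \<in> lists ?P" "foldl g i (h t) \<in> F" "b t = ?n" by auto
    then have "h t \<in> ?V"
      using Q(5) h_lists by blast
    then obtain u v where uv: "(u, v) \<in> W" "h t = rev (conv2 (u, v))" by auto
    have "x t = take (length t) (x t) @ b t"
      by (simp add: b_def)
    also have "\<dots> = ?n @ map Some (rev u) @ ?n"
      unfolding t(3) fst_h[symmetric] uv(2) rev_fst[OF uv(1)] by simp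
    finally have "map fst t = map Some (rev u) @ ?n"
      by (simp add: x_def)
    moreover have "map snd t = map Some (rev v)"
      using rev_snd[OF uv(1)] snd_h[of t] uv(2) by simp
    ultimately have "t = conv2 (rev u, rev v)"
      using uv(1) by (intro pad_word_eqI) (simp_all add: conv_fst conv_snd)
    then show "t \<in> conv2 ` (\<lambda>(u, v). (rev u, rev v)) ` W"
      using uv(1) by force
  qed
  moreover have "regular ?P {t \<in> lists ?P. (\<lambda>(q, y). q \<in> F \<and> y = ?n) (foldl g i (h t), b t)}"
  proof (rule regularI_fun[where g = g'])
    show "finite ?P" "finite (Q \<times> {y. set y \<subseteq> insert None (Some ` A) \<and> length y = d})"
      using \<open>finite A\<close> \<open>finite Q\<close> by (auto simp: finite_pad_alphabet intro!: finite_lists_length_eq)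
    show "(foldl g i (h t), b t) \<in> Q \<times> {y. set y \<subseteq> insert None (Some ` A) \<and> length y = d}"
      if "t \<in> lists ?P" for t
    proof -
      have "set (b t) \<subseteq> set (x t)" "length (b t) = d"
        by (simp only: b_def set_drop_subset) (simp add: b_def x_def)
      then show ?thesis
        using Q(3)[OF Q(4) h_lists[OF that]] x_set[OF that] by simp
    qed
    show "(foldl g i (h (t @ [s])), b (t @ [s])) = g' (foldl g i (h t), b t) s" for t s
      by (cases s) (simp add: step g'_def)
  qed
  ultimately show ?thesis
    using \<open>finite A\<close> sub by (auto simp: FA2_def)
qed

text \<open>Single-valuedness in both directions bounds the length difference on both sides, so
  \<open>W\<close> splits into finitely many pieces of constant difference, each of which can be
  reversed.\<close>

lemma FA2_rev:
  assumes W: "FA2 A W"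
    and "single_valued W" "single_valued (W\<inverse>)"
  shows "FA2 A ((\<lambda>(u, v). (rev u, rev v)) ` W)"
proof -
  let ?r = "\<lambda>(u, v). (rev u, rev v)"
  have W': "FA2 A (W\<inverse>)"
    using W by (rule FA2_swap)
  have "finite A"
    using W by (simp add: FA2_def)
  obtain M where M: "\<forall>(u, v) \<in> W. length v \<le> length u + M"
    using FA2_length_bound[OF W assms(2)] ..
  obtain N where N: "\<forall>(v, u) \<in> W\<inverse>. length u \<le> length v + N"
    using FA2_length_bound[OF W' assms(3)] ..
  let ?D = "\<lambda>V d. {(u, v) \<in> V. length v = length u + d}"
  have D: "FA2 A (?r ` ?D V d)" if "FA2 A V" for V d
    by (rule FA2_rev_length_diff[OF FA2_length_diff[OF that]]) auto
  \<comment> \<open>Pairs with a longer first word are treated through the converse; pairs of equal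
    length occur in both unions.\<close>
  have "FA2 A ((\<Union>d\<in>{..M}. ?r ` ?D W d) \<union> (\<Union>d\<in>{..N}. ?r ` ?D (W\<inverse>) d)\<inverse>)"
    using W W' \<open>finite A\<close> by (intro FA2_Un FA2_UN FA2_swap D) auto
  also have "(\<Union>d\<in>{..M}. ?r ` ?D W d) \<union> (\<Union>d\<in>{..N}. ?r ` ?D (W\<inverse>) d)\<inverse> = ?r ` W"
    (is "?A \<union> ?B = _")
  proof (intro equalityI subsetI)
    fix p
    assume "p \<in> ?r ` W"
    then obtain u v where uv: "(u, v) \<in> W" "p = (rev u, rev v)" by auto
    show "p \<in> ?A \<union> ?B"
    proof (cases "length u \<le> length v")
      case True
      then have "(u, v) \<in> ?D W (length v - length u)" "length v - length u \<le> M"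
        using uv M by auto
      then have "p \<in> ?A"
        unfolding uv(2) by force
      then show ?thesis ..
    next
      case False
      then have "(v, u) \<in> ?D (W\<inverse>) (length u - length v)" "length u - length v \<le> N"
        using uv bspec[OF N, of "(v, u)"] by auto
      then have "p \<in> ?B"
        unfolding uv(2) by force
      then show ?thesis ..
    qed
  qed force
  finally show ?thesis .
qed

section \<open>Biautomatic groups\<close>

lemma regular_inverse_language:
  assumes "regular X L" "m_inv G ` X \<subseteq> X"
  shows "regular X (inverse_language G L)"
proof -
  have "regular X (rev ` map (m_inv G) ` L)"
    using assms by (intro regular_rev regular_map) (auto intro: regular_finite)
  then show ?thesis
    by (simp add: inverse_language_def image_image)
qed

lemma automatic_structure_FA2:
  assumes "part_of_automatic_structure G X L"
  shows "FA2 X {(u, v). u \<in> L \<and> v \<in> L \<and> word_value G u = word_value G v}"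
    and "x \<in> X \<Longrightarrow> FA2 X {(u, v). u \<in> L \<and> v \<in> L \<and> word_value G u = word_value G (v @ [x])}"
proof -
  have X: "finite X" "L \<subseteq> lists X"
    using assms by (auto simp: part_of_automatic_structure_def dest: regular_finite)
  have "FA_recognizable X 2 {[u, v] |u v. u \<in> L \<and> v \<in> L \<and> P u v} \<longleftrightarrow>
      FA2 X {(u, v). u \<in> L \<and> v \<in> L \<and> P u v}" for P
  proof -
    have "{(u, v). u \<in> L \<and> v \<in> L \<and> P u v} \<subseteq> lists X \<times> lists X"
      using X(2) by auto
    from FA_recognizable_iff_FA2[OF X(1) this] show ?thesis by simp
  qed
  then show "FA2 X {(u, v). u \<in> L \<and> v \<in> L \<and> word_value G u = word_value G v}"
    and "x \<in> X \<Longrightarrow> FA2 X {(u, v). u \<in> L \<and> v \<in> L \<and> word_value G u = word_value G (v @ [x])}"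
    using assms by (auto simp: part_of_automatic_structure_def)
qed

section \<open>Values of words and of their formal inverses\<close>

context group
begin

lemma word_value_closed: "w \<in> lists (carrier G) \<Longrightarrow> word_value G w \<in> carrier G"
  by (induction w) (auto simp: word_value_def)

lemma word_value_append:
  "u \<in> lists (carrier G) \<Longrightarrow> v \<in> lists (carrier G) \<Longrightarrow>
    word_value G (u @ v) = word_value G u \<otimes> word_value G v"
proof (induction u)
  case Nil
  then show ?case
    using word_value_closed[of v] by (simp add: word_value_def)
next
  case (Cons a u)
  have "word_value G u \<in> carrier G" "word_value G v \<in> carrier G"
    using Cons.prems by (auto intro!: word_value_closed)
  moreover have "word_value G (u @ v) = word_value G u \<otimes> word_value G v"
    using Cons by auto
  ultimately show ?case
    using Cons.prems by (simp add: word_value_def m_assoc)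
qed

lemma word_value_snoc:
  "u \<in> lists (carrier G) \<Longrightarrow> x \<in> carrier G \<Longrightarrow> word_value G (u @ [x]) = word_value G u \<otimes> x"
  using word_value_append[of u "[x]"] by (simp add: word_value_def)

lemma word_value_inverse:
  "w \<in> lists (carrier G) \<Longrightarrow> word_value G (rev (map (m_inv G) w)) = inv (word_value G w)"
proof (induction w)
  case (Cons a w)
  have "rev (map (m_inv G) w) \<in> lists (carrier G)" "word_value G w \<in> carrier G"
    using Cons.prems by (auto intro!: word_value_closed)
  moreover have "word_value G (a # w) = a \<otimes> word_value G w"
    by (simp add: word_value_def)
  ultimately show ?case
    using Cons by (simp add: word_value_snoc inv_mult_group)
qed (simp add: word_value_def)

end

text \<open>Carries relations over the generators to the numerical alphabet that
  \<open>Cayley_graph_biautomatic\<close> asks for; \<open>eq\<close> says that \<open>P'\<close> on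
  codes mirrors \<open>P\<close> on words.\<close>

lemma FA_recognizable_rename:
  assumes "FA2 X {(u, v). u \<in> R \<and> v \<in> R \<and> P u v}"
    and eq: "\<And>u v. u \<in> R \<Longrightarrow> v \<in> R \<Longrightarrow> P' (map e u) (map e v) \<longleftrightarrow> P u v"
    and R: "R \<subseteq> lists X"
  shows "FA_recognizable (e ` X) 2 {[u, v] |u v. u \<in> map e ` R \<and> v \<in> map e ` R \<and> P' u v}"
proof -
  let ?W = "{(u, v). u \<in> map e ` R \<and> v \<in> map e ` R \<and> P' u v}"
  have fin: "finite (e ` X)"
    using assms(1) by (simp add: FA2_def)
  have "FA2 (e ` X) ((\<lambda>(u, v). (map e u, map e v)) ` {(u, v). u \<in> R \<and> v \<in> R \<and> P u v})"
    by (rule FA2_map[OF assms(1) fin]) simp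
  also have "(\<lambda>(u, v). (map e u, map e v)) ` {(u, v). u \<in> R \<and> v \<in> R \<and> P u v} = ?W"
    using eq by fastforce
  finally have "FA2 (e ` X) ?W" .
  then show ?thesis
    using FA_recognizable_iff_FA2[OF fin, of ?W] by (simp add: FA2_def)
qed

text \<open>Removing every word that has a shortlex-smaller equivalent in \<open>L\<close> leaves
  one word per element: at most one since the order is total, at least one since it is well-founded.
  The code \<open>e\<close> supplies the order on letters.\<close>

lemma (in group) shortlex_representatives:
  fixes e :: "'a \<Rightarrow> nat"
  assumes e: "inj_on e X" and L: "L \<subseteq> lists X" and onto: "word_value G ` L = S"
    and reg: "regular X L"
    and FA: "FA2 X {(u, v). u \<in> L \<and> v \<in> L \<and> word_value G u = word_value G v}"
  obtains R where "R \<subseteq> L" "regular X R" "bij_betw (word_value G) R S"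
proof -
  let ?E = "{(u, v). u \<in> L \<and> v \<in> L \<and> word_value G u = word_value G v}"
  let ?D = "{u. \<exists>v. (u, v) \<in> ?E \<and> (map e v, map e u) \<in> lenlex less_than}"
  have "regular X (L - ?D)"
    using reg regular_shortlex_dominated[OF FA] by (rule regular_Diff)
  moreover have "inj_on (word_value G) (L - ?D)"
  proof (rule inj_onI)
    fix u v
    assume uv: "u \<in> L - ?D" "v \<in> L - ?D" "word_value G u = word_value G v"
    then have "(map e u, map e v) \<notin> lenlex less_than" "(map e v, map e u) \<notin> lenlex less_than"
      by auto
    moreover have "total (lenlex less_than)"
      by (intro total_lenlex total_less_than)
    ultimately have "map e u = map e v"
      by (metis UNIV_I total_on_def)
    \<comment> \<open>Totality only yields equal codes; injectivity of \<open>e\<close> on the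
      letters that occur turns this into equality of words.\<close>
    moreover have "inj_on e (set u \<union> set v)"
      using uv L by (intro inj_on_subset[OF e]) auto
    ultimately show "u = v"
      by (rule map_inj_on)
  qed
  moreover have "g \<in> word_value G ` (L - ?D)" if "g \<in> S" for g
  proof -
    have wf: "wf (inv_image (lenlex less_than) (map e))"
      by (intro wf_inv_image wf_lenlex wf_less_than)
    obtain w where "w \<in> {u \<in> L. word_value G u = g}"
      using \<open>g \<in> S\<close> onto by blast
    then obtain u where "u \<in> {u \<in> L. word_value G u = g}"
      "\<And>v. (v, u) \<in> inv_image (lenlex less_than) (map e) \<Longrightarrow> v \<notin> {u \<in> L. word_value G u = g}"
      by (rule wfE_min[OF wf]) blast
    then show ?thesis
      by (intro image_eqI[of _ _ u]) (simp, fastforce)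
  qed
  then have "word_value G ` (L - ?D) = S"
    using onto by blast
  ultimately show thesis
    by (intro that[of "L - ?D"]) (auto simp: bij_betw_def)
qed

text \<open>The last assumption makes \<open>S\<close> the graph of a partial injection, and
  \<open>f\<close> is injective on all words involved. The swap anticipates that inverting
  \<open>x u = v\<close> exchanges the roles of \<open>u\<close> and \<open>v\<close>.\<close>

lemma single_valued_swap_image:
  assumes "inj_on f R" "S \<subseteq> R \<times> R"
    and "\<And>u u' v v'. (u, v) \<in> S \<Longrightarrow> (u', v') \<in> S \<Longrightarrow> u = u' \<longleftrightarrow> v = v'"
  shows "single_valued ((\<lambda>(u, v). (f v, f u)) ` S)"
    and "single_valued (((\<lambda>(u, v). (f v, f u)) ` S)\<inverse>)"
proof -
  have "f u = f u' \<longleftrightarrow> f v = f v'" if "(u, v) \<in> S" "(u', v') \<in> S" for u u' v v'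
    using that assms inj_on_eq_iff[OF assms(1)] by blast
  then show "single_valued ((\<lambda>(u, v). (f v, f u)) ` S)"
    and "single_valued (((\<lambda>(u, v). (f v, f u)) ` S)\<inverse>)"
    by (auto simp: single_valued_def)
qed

theorem proposition8p4:
  fixes G :: "('g, 'm) monoid_scheme"
  assumes "group G"
    and "Thurston_biautomatic G"
  shows "Cayley_graph_biautomatic G"
proof -
  interpret group G by fact
  let ?val = "word_value G" and ?inv = "\<lambda>w. rev (map (m_inv G) w)"
  obtain X L where gen: "finite_generating_set G X" and inv_X: "m_inv G ` X = X"
    and L: "L \<subseteq> lists X"
    and aut: "part_of_automatic_structure G X L"
    and aut': "part_of_automatic_structure G X (inverse_language G L)"
    using assms(2) by (auto simp: Thurston_biautomatic_def)
  have X: "finite X" "X \<subseteq> carrier G"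
    using gen by (auto simp: finite_generating_set_def)
  obtain e :: "'g \<Rightarrow> nat" where e: "inj_on e X"
    using finite_imp_inj_to_nat_seg[OF X(1)] by blast
  have reg: "regular X L" and onto: "?val ` L = carrier G"
    using aut by (auto simp: part_of_automatic_structure_def)
  obtain R where RL: "R \<subseteq> L" and R: "regular X R" "bij_betw ?val R (carrier G)"
    using shortlex_representatives[OF e L onto reg automatic_structure_FA2(1)[OF aut]] .
  have RX: "w \<in> lists X" and RC: "w \<in> lists (carrier G)" if "w \<in> R" for w
    using that RL L X(2) lists_mono[OF X(2)] by blast+
  have val: "?val w \<in> carrier G" if "w \<in> R" for w
    using word_value_closed[OF RC[OF that]] .
  have inj: "u = v" if "u \<in> R" "v \<in> R" "?val u = ?val v" for u v
    using R(2) that by (auto simp: bij_betw_def dest: inj_onD)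
  \<comment> \<open>Decodes numbers into generators, then evaluates; on codes of words in
    \<open>R\<close> the decoding is exact.\<close>
  define \<nu> where "\<nu> w = ?val (map (inv_into X e) w)" for w
  have \<nu>: "\<nu> (map e w) = ?val w" if "w \<in> R" for w
  proof -
    have "map (inv_into X e) (map e w) = w"
      using RX[OF that] e by (auto intro!: map_idI)
    then show ?thesis by (simp add: \<nu>_def)
  qed
  have "bij_betw \<nu> (map e ` R) (carrier G)"
  proof (rule bij_betw_imageI)
    show "inj_on \<nu> (map e ` R)"
      using \<nu> inj by (auto intro!: inj_onI arg_cong[of _ _ "map e"])
    show "\<nu> ` map e ` R = carrier G"
      using R(2) \<nu> by (simp add: image_image bij_betw_def)
  qed
  moreover have "regular (e ` X) (map e ` R)"
    using R(1) X(1) by (intro regular_map) auto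
  moreover have "FA_recognizable (e ` X) 2
      {[u, v] |u v. u \<in> map e ` R \<and> v \<in> map e ` R \<and> \<nu> u \<otimes>\<^bsub>G\<^esub> x = \<nu> v}" if "x \<in> X" for x
  proof (rule FA_recognizable_rename)
    let ?W = "{(u, v). u \<in> L \<and> v \<in> L \<and> ?val u = ?val (v @ [x])}"
    \<comment> \<open>The automatic structure puts the multiplied word second, the Cayley graph
      relation puts it first; hence the converse.\<close>
    have "FA2 X ((?W \<inter> R \<times> R)\<inverse>)"
      using automatic_structure_FA2(2)[OF aut that] R(1) by (intro FA2_swap FA2_restrict)
    also have "(?W \<inter> R \<times> R)\<inverse> = {(u, v). u \<in> R \<and> v \<in> R \<and> ?val u \<otimes>\<^bsub>G\<^esub> x = ?val v}"
      using RL that X(2) RC by (auto simp: word_value_snoc subset_iff simp del: lists_eq_set)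
    finally show "FA2 X {(u, v). u \<in> R \<and> v \<in> R \<and> ?val u \<otimes>\<^bsub>G\<^esub> x = ?val v}" .
  qed (use \<nu> RX in auto)
  moreover have "FA_recognizable (e ` X) 2
      {[u, v] |u v. u \<in> map e ` R \<and> v \<in> map e ` R \<and> x \<otimes>\<^bsub>G\<^esub> \<nu> u = \<nu> v}" if x: "x \<in> X" for x
  proof (rule FA_recognizable_rename)
    let ?S = "{(u, v). u \<in> R \<and> v \<in> R \<and> x \<otimes>\<^bsub>G\<^esub> ?val u = ?val v}"
    let ?L' = "inverse_language G L" and ?R' = "inverse_language G R"
    \<comment> \<open>The equation \<open>x u = v\<close> in the group is equivalent to
      \<open>v^-1 = u^-1 x^-1\<close>, a right multiplication by the generator \<open>x^-1\<close>
      in the inverse language, with the two words exchanged.\<close>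
    let ?W = "{(u, v). u \<in> ?L' \<and> v \<in> ?L' \<and> ?val u = ?val (v @ [inv\<^bsub>G\<^esub> x])} \<inter> ?R' \<times> ?R'"
    have xC: "x \<in> carrier G" and ix: "inv\<^bsub>G\<^esub> x \<in> X"
      using x X(2) inv_X by auto
    have val_inv: "?val (?inv w) = inv\<^bsub>G\<^esub> ?val w"
      "?val (?inv w @ [inv\<^bsub>G\<^esub> x]) = inv\<^bsub>G\<^esub> (x \<otimes>\<^bsub>G\<^esub> ?val w)" if "w \<in> R" for w
    proof -
      have "?inv w \<in> lists (carrier G)"
        using RC[OF that] by auto
      then show "?val (?inv w) = inv\<^bsub>G\<^esub> ?val w"
        "?val (?inv w @ [inv\<^bsub>G\<^esub> x]) = inv\<^bsub>G\<^esub> (x \<otimes>\<^bsub>G\<^esub> ?val w)"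
        using RC[OF that] xC val[OF that]
        by (simp_all add: word_value_snoc word_value_inverse inv_mult_group del: lists_eq_set)
    qed
    have inv_inv_word: "map (m_inv G) (rev (?inv w)) = w" if "w \<in> R" for w
      using RC[OF that] by (auto intro!: map_idI)
    have inv_eq: "inv\<^bsub>G\<^esub> a = inv\<^bsub>G\<^esub> b \<longleftrightarrow> a = b" if "a \<in> carrier G" "b \<in> carrier G" for a b
      using that by (metis inv_inv)
    have W: "?W = (\<lambda>(u, v). (?inv v, ?inv u)) ` ?S"
    proof -
      have "(?inv v, ?inv u) \<in> ?W \<longleftrightarrow> (u, v) \<in> ?S" if "u \<in> R" "v \<in> R" for u v
        using that RL val xC by (auto simp: inverse_language_def val_inv inv_eq)
      then show ?thesis
        unfolding inverse_language_def by fast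
    qed
    have "FA2 X ?W"
      using automatic_structure_FA2(2)[OF aut' ix] R(1) inv_X
      by (intro FA2_restrict regular_inverse_language) auto
    \<comment> \<open>Left multiplication by \<open>x\<close> is injective and words in
      \<open>R\<close> are determined by their values, so \<open>?S\<close> is a partial injection;
      this is what reversal requires.\<close>
    moreover have "single_valued ?W" "single_valued (?W\<inverse>)"
    proof -
      have "inj_on ?inv R"
        using inv_inv_word by (rule inj_on_inverseI)
      moreover have "u = u' \<longleftrightarrow> v = v'" if "(u, v) \<in> ?S" "(u', v') \<in> ?S" for u v u' v'
      proof -
        have "x \<otimes>\<^bsub>G\<^esub> ?val u = ?val v" "x \<otimes>\<^bsub>G\<^esub> ?val u' = ?val v'"
          using that by auto
        moreover have "u \<in> R" "v \<in> R" "u' \<in> R" "v' \<in> R"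
          using that by auto
        ultimately show ?thesis
          using inj val xC by (metis Units_eq Units_l_cancel)
      qed
      ultimately show "single_valued ?W" "single_valued (?W\<inverse>)"
        unfolding W by (intro single_valued_swap_image[where R = R]; auto)+
    qed
    ultimately have "FA2 X ((\<lambda>(u, v). (rev u, rev v)) ` ?W)"
      by (rule FA2_rev)
    \<comment> \<open>Reversal has restored the order of the letters; inverting each letter and
      exchanging the two words recovers \<open>?S\<close>.\<close>
    then have "FA2 X (((\<lambda>(u, v). (map (m_inv G) u, map (m_inv G) v)) ` (\<lambda>(u, v). (rev u, rev v)) ` ?W)\<inverse>)"
      using X(1) inv_X by (intro FA2_swap FA2_map[where A = X]) auto
    also have "(\<lambda>(u, v). (map (m_inv G) u, map (m_inv G) v)) ` (\<lambda>(u, v). (rev u, rev v)) ` ?W =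
      ?S\<inverse>"
    proof -
      have "(\<lambda>(u, v). (map (m_inv G) u, map (m_inv G) v)) ` (\<lambda>(u, v). (rev u, rev v)) ` ?W =
        (\<lambda>(u, v). (map (m_inv G) (rev (?inv v)), map (m_inv G) (rev (?inv u)))) ` ?S"
        unfolding W image_image by (simp add: case_prod_beta)
      also have "\<dots> = (\<lambda>(u, v). (v, u)) ` ?S"
        by (intro image_cong refl) (clarsimp simp only: inv_inv_word mem_Collect_eq case_prod_conv simp_thms)
      also have "\<dots> = ?S\<inverse>" by auto
      finally show ?thesis .
    qed
    finally show "FA2 X ?S" by simp
  qed (use \<nu> RX in auto)
  ultimately show ?thesis
    unfolding Cayley_graph_biautomatic_def using gen X(1)
    by (intro exI[of _ X] exI[of _ "e ` X"] exI[of _ "map e ` R"] exI[of _ \<nu>] conjI ballI) auto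
qed

end
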